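(* Let $X$ be a discrete random variable with finite support $S$ of cardinality $N$, and let $\alpha>0$, $\alpha\neq 1$. Then, among all discrete random variables with finite support of cardinality $N$ (i.e. among all probability vectors $(p_1,\dots,p_N)$), with $N$ and $\alpha$ fixed, $X$ has maximum Tsallis extropy $JS_\alpha(X)$ if and only if $X$ is uniformly distributed, i.e. $p_i=\frac1N$ for all $i=1,\dots,N$.
   Context: $X$ is a discrete random variable with support $S=\{x_1,\dots,x_N\}$ and probability vector $\mathbf p=(p_1,\dots,p_N)$, $p_i=\mathbb P(X=x_i)\ge 0$, $\sum_{i=1}^N p_i=1$ (zero entries are allowed, e.g. the vector $(1,0,\dots,0)$ is admitted). For $\alpha>0$, $\alpha\neq1$, the Tsallis extropy of $X$ is $$JS_\alpha(X)=\frac{1}{\alpha-1}\left(N-1-\sum_{i=1}^N(1-p_i)^\alpha\right).$$ *)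

theory Defs
  imports "HOL-Probability.Probability"
begin

(* Vectors indexed by {1..N} are functions on nat; values outside {1..N} are irrelevant. *)
definition prob_vector :: "nat \<Rightarrow> (nat \<Rightarrow> real) \<Rightarrow> bool" where
  "prob_vector N p \<longleftrightarrow> (\<forall>i\<in>{1..N}. 0 \<le> p i) \<and> (\<Sum>i=1..N. p i) = 1"

(* X has support S = {x 1, ..., x N}, with N distinct points, in the sense that X lies in S
   almost surely. Points of probability zero are allowed in S. *)
definition discrete_rv :: "'a measure \<Rightarrow> ('a \<Rightarrow> real) \<Rightarrow> nat \<Rightarrow> (nat \<Rightarrow> real) \<Rightarrow> bool" where
  "discrete_rv M X N x \<longleftrightarrow>
     prob_space M \<and> X \<in> borel_measurable M \<and> inj_on x {1..N} \<and>
     (AE \<omega> in M. X \<omega> \<in> x ` {1..N})"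

definition prob_vector_of :: "'a measure \<Rightarrow> ('a \<Rightarrow> real) \<Rightarrow> (nat \<Rightarrow> real) \<Rightarrow> nat \<Rightarrow> real" where
  "prob_vector_of M X x i = measure M {\<omega> \<in> space M. X \<omega> = x i}"

definition tsallis_extropy :: "real \<Rightarrow> nat \<Rightarrow> (nat \<Rightarrow> real) \<Rightarrow> real" where
  "tsallis_extropy \<alpha> N p = 1 / (\<alpha> - 1) * (real N - 1 - (\<Sum>i=1..N. (1 - p i) powr \<alpha>))"

end

theory Submission
  imports Defs
begin

text \<open>
  The function \<open>t \<mapsto> t powr \<alpha> / (\<alpha> - 1)\<close> is strictly convex on \<open>[0, \<infinity>)\<close>, both for
  \<open>\<alpha> > 1\<close> and for \<open>0 < \<alpha> < 1\<close>, since its derivative is \<open>\<alpha> / (\<alpha> - 1) * t powr (\<alpha> - 1)\<close>.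
  It therefore lies strictly above its tangent at \<open>c = 1 - 1 / N\<close> except at the point of
  tangency (\<open>powr_tangent_less\<close>). Adding up this inequality at the points \<open>1 - p i\<close> removes
  the linear part, because every probability vector has \<open>(\<Sum>i=1..N. 1 - p i) = N - 1 = N * c\<close>.
  What remains says that each probability vector other than the uniform one has strictly
  smaller extropy than the uniform one (\<open>tsallis_extropy_less_uniform\<close>). For
  \<open>\<alpha> < 1\<close> there is no tangent at \<open>c = 0\<close>, but \<open>c = 0\<close> only happens for \<open>N = 1\<close>, and
  then the uniform vector is the only probability vector.
\<close>

text \<open>
  For \<open>t > 0\<close> the mean value theorem turns the increment of \<open>t powr \<alpha>\<close> into
  \<open>\<alpha> * \<xi> powr (\<alpha> - 1) * (t - c)\<close> for some \<open>\<xi>\<close> strictly between \<open>t\<close> and \<open>c\<close>. Dividing by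
  \<open>\<alpha> - 1\<close> makes \<open>\<xi> powr (\<alpha> - 1)\<close> increasing in \<open>\<xi>\<close> whatever the sign of \<open>\<alpha> - 1\<close>, so
  replacing \<open>\<xi>\<close> by \<open>c\<close> decreases the product on either side of \<open>c\<close>.
\<close>

lemma powr_tangent_less:
  fixes \<alpha> c t :: real
  assumes \<alpha>: "\<alpha> > 0" "\<alpha> \<noteq> 1" and c: "c > 0" and t: "t \<ge> 0" "t \<noteq> c"
  shows "c powr \<alpha> / (\<alpha> - 1) + \<alpha> * c powr (\<alpha> - 1) / (\<alpha> - 1) * (t - c) < t powr \<alpha> / (\<alpha> - 1)"
proof (cases "t = 0")
  case True
  \<comment> \<open>Here the tangent has the value \<open>- (c powr \<alpha>)\<close>.\<close>
  have "c powr (\<alpha> - 1) * c = c powr \<alpha>"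
    using c by (simp add: powr_diff)
  then have "\<alpha> * c powr (\<alpha> - 1) / (\<alpha> - 1) * (t - c) = - \<alpha> * c powr \<alpha> / (\<alpha> - 1)"
    using True by (simp add: mult.assoc)
  moreover have "c powr \<alpha> / (\<alpha> - 1) + - \<alpha> * c powr \<alpha> / (\<alpha> - 1) = - (c powr \<alpha>)"
    unfolding add_divide_distrib[symmetric] using \<alpha>
    by (simp add: divide_eq_eq left_diff_distrib mult.commute right_diff_distrib)
  ultimately have "c powr \<alpha> / (\<alpha> - 1) + \<alpha> * c powr (\<alpha> - 1) / (\<alpha> - 1) * (t - c) = - (c powr \<alpha>)"
    by simp
  then show ?thesis
    using True c by simp
next
  case False
  define f where "f = (\<lambda>s::real. s powr \<alpha> / (\<alpha> - 1))"
  define f' where "f' = (\<lambda>s::real. \<alpha> * s powr (\<alpha> - 1) / (\<alpha> - 1))"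
  have deriv: "(f has_real_derivative f' s) (at s)" if "s > 0" for s
    unfolding f_def f'_def using that \<alpha>
    by (auto intro!: derivative_eq_intros)
  have mono: "f' r < f' s" if "0 < r" "r < s" for r s
  proof (cases "\<alpha> > 1")
    case True
    then show ?thesis
      using that by (simp add: f'_def divide_strict_right_mono powr_less_mono2)
  next
    case False
    then have "s powr (\<alpha> - 1) < r powr (\<alpha> - 1)"
      using \<alpha> that by (intro powr_less_mono2_neg) auto
    then show ?thesis
      using False \<alpha> by (simp add: f'_def divide_strict_right_mono_neg)
  qed
  have "f c + f' c * (t - c) < f t"
  proof (cases "t < c")
    case True
    then obtain \<xi> where \<xi>: "t < \<xi>" "\<xi> < c" "f c - f t = (c - t) * f' \<xi>"
      using MVT2[of t c f f'] deriv False t by force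
    then have "(c - t) * f' \<xi> < (c - t) * f' c"
      using mono[of \<xi> c] True False t by (intro mult_strict_left_mono) auto
    then show ?thesis
      using \<xi>(3) by (simp add: algebra_simps)
  next
    case False
    then have "c < t" using t by simp
    then obtain \<xi> where \<xi>: "c < \<xi>" "\<xi> < t" "f t - f c = (t - c) * f' \<xi>"
      using MVT2[of c t f f'] deriv c by force
    then have "(t - c) * f' c < (t - c) * f' \<xi>"
      using mono[of c \<xi>] \<open>c < t\<close> c by (intro mult_strict_left_mono) auto
    then show ?thesis
      using \<xi>(3) by (simp add: algebra_simps)
  qed
  then show ?thesis
    by (simp add: f_def f'_def)
qed

lemma tsallis_extropy_cong:
  assumes "\<And>i. i \<in> {1..N} \<Longrightarrow> p i = q i"
  shows "tsallis_extropy \<alpha> N p = tsallis_extropy \<alpha> N q"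
  using assms by (simp add: tsallis_extropy_def)

lemma prob_vector_le_1:
  assumes "prob_vector N p" "i \<in> {1..N}"
  shows "p i \<le> 1"
  using assms member_le_sum[of i "{1..N}" p] by (auto simp: prob_vector_def)

lemma prob_vector_uniform: "N > 0 \<Longrightarrow> prob_vector N (\<lambda>_. 1 / real N)"
  by (simp add: prob_vector_def)

lemma prob_vector_dimension_pos: "prob_vector N p \<Longrightarrow> N > 0"
  by (cases N) (auto simp: prob_vector_def)

lemma tsallis_extropy_less_uniform:
  assumes \<alpha>: "\<alpha> > 0" "\<alpha> \<noteq> 1" and p: "prob_vector N p"
    and nonuniform: "j \<in> {1..N}" "p j \<noteq> 1 / real N"
  shows "tsallis_extropy \<alpha> N p < tsallis_extropy \<alpha> N (\<lambda>_. 1 / real N)"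
proof -
  define c where "c = 1 - 1 / real N"
  define m where "m = \<alpha> * c powr (\<alpha> - 1) / (\<alpha> - 1)"
  have "N > 0" using prob_vector_dimension_pos[OF p] .
  have "N \<noteq> 1"
    using p nonuniform by (auto simp: prob_vector_def)
  with \<open>N > 0\<close> have "c > 0"
    by (simp add: c_def)
  have tangent: "c powr \<alpha> / (\<alpha> - 1) + m * ((1 - p i) - c) < (1 - p i) powr \<alpha> / (\<alpha> - 1)"
    if "i \<in> {1..N}" "p i \<noteq> 1 / real N" for i
    unfolding m_def using that \<alpha> \<open>c > 0\<close> prob_vector_le_1[OF p, of i]
    by (intro powr_tangent_less) (auto simp: c_def)
  have tangent_le: "c powr \<alpha> / (\<alpha> - 1) + m * ((1 - p i) - c) \<le> (1 - p i) powr \<alpha> / (\<alpha> - 1)"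
    if "i \<in> {1..N}" for i
    using tangent[OF that] by (cases "p i = 1 / real N") (auto simp: c_def)
  have "(\<Sum>i=1..N. (1 - p i) - c) = 0"
    using p \<open>N > 0\<close> by (simp add: sum_subtractf prob_vector_def c_def right_diff_distrib)
  then have "(\<Sum>i=1..N. c powr \<alpha> / (\<alpha> - 1))
      = (\<Sum>i=1..N. c powr \<alpha> / (\<alpha> - 1) + m * ((1 - p i) - c))"
    by (simp add: sum.distrib flip: sum_distrib_left)
  also have "\<dots> < (\<Sum>i=1..N. (1 - p i) powr \<alpha> / (\<alpha> - 1))"
    using tangent_le tangent[OF nonuniform] nonuniform(1)
    by (intro sum_strict_mono_ex1) blast+
  finally have "(\<Sum>i=1..N. c powr \<alpha>) / (\<alpha> - 1) < (\<Sum>i=1..N. (1 - p i) powr \<alpha>) / (\<alpha> - 1)"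
    by (simp add: sum_divide_distrib)
  then show ?thesis
    by (simp add: tsallis_extropy_def c_def diff_divide_distrib)
qed

lemma is_arg_max_tsallis_extropy_iff:
  assumes \<alpha>: "\<alpha> > 0" "\<alpha> \<noteq> 1" and p: "prob_vector N p"
  shows "is_arg_max (tsallis_extropy \<alpha> N) (prob_vector N) p \<longleftrightarrow>
         (\<forall>i\<in>{1..N}. p i = 1 / real N)"
proof
  assume "is_arg_max (tsallis_extropy \<alpha> N) (prob_vector N) p"
  then have "\<not> tsallis_extropy \<alpha> N p < tsallis_extropy \<alpha> N (\<lambda>_. 1 / real N)"
    using prob_vector_uniform[OF prob_vector_dimension_pos[OF p]]
    unfolding is_arg_max_def by blast
  then show "\<forall>i\<in>{1..N}. p i = 1 / real N"
    using tsallis_extropy_less_uniform[OF \<alpha> p] by blast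
next
  assume uniform: "\<forall>i\<in>{1..N}. p i = 1 / real N"
  have "\<not> tsallis_extropy \<alpha> N p < tsallis_extropy \<alpha> N q" if q: "prob_vector N q" for q
  proof (cases "\<forall>i\<in>{1..N}. q i = 1 / real N")
    case True
    then show ?thesis
      using uniform tsallis_extropy_cong[of N p q \<alpha>] by simp
  next
    case False
    then have "tsallis_extropy \<alpha> N q < tsallis_extropy \<alpha> N (\<lambda>_. 1 / real N)"
      using tsallis_extropy_less_uniform[OF \<alpha> q] by auto
    also have "\<dots> = tsallis_extropy \<alpha> N p"
      using uniform by (intro tsallis_extropy_cong) simp
    finally show ?thesis by simp
  qed
  then show "is_arg_max (tsallis_extropy \<alpha> N) (prob_vector N) p"
    using p by (auto simp: is_arg_max_def)
qed

text \<open>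
  The events \<open>X = x i\<close> are disjoint because the points \<open>x i\<close> are distinct, and they cover
  almost all of the space because \<open>X\<close> lies in the support almost surely.
\<close>

lemma prob_vector_prob_vector_of:
  assumes "discrete_rv M X N x"
  shows "prob_vector N (prob_vector_of M X x)"
proof -
  from assms interpret prob_space M
    by (simp add: discrete_rv_def)
  have [measurable]: "X \<in> borel_measurable M"
    and inj: "inj_on x {1..N}" and support: "AE \<omega> in M. X \<omega> \<in> x ` {1..N}"
    using assms by (auto simp: discrete_rv_def)
  define A where "A i = {\<omega> \<in> space M. X \<omega> = x i}" for i
  have A: "A i \<in> events" for i
    unfolding A_def by measurable
  have "disjoint_family_on A {1..N}"
    using inj_onD[OF inj] unfolding disjoint_family_on_def A_def by fastforce
  then have "(\<Sum>i=1..N. prob (A i)) = prob (\<Union>i\<in>{1..N}. A i)"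
    using A by (intro finite_measure_finite_Union[symmetric]) auto
  also have "\<dots> = 1"
  proof (rule prob_eq_1[THEN iffD2])
    show "AE \<omega> in M. \<omega> \<in> (\<Union>i\<in>{1..N}. A i)"
      using support AE_space by eventually_elim (auto simp: A_def)
  qed (use A in auto)
  finally show ?thesis
    by (simp add: prob_vector_def prob_vector_of_def A_def)
qed

theorem theorem3p1:
  fixes M :: "'a measure" and X :: "'a \<Rightarrow> real"
    and N :: nat and x :: "nat \<Rightarrow> real" and \<alpha> :: real
  assumes "discrete_rv M X N x"
    and "\<alpha> > 0" and "\<alpha> \<noteq> 1"
  shows "is_arg_max (tsallis_extropy \<alpha> N) (prob_vector N) (prob_vector_of M X x) \<longleftrightarrow>
         (\<forall>i\<in>{1..N}. prob_vector_of M X x i = 1 / real N)"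
  using is_arg_max_tsallis_extropy_iff[OF assms(2,3) prob_vector_prob_vector_of[OF assms(1)]] .

end
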